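(* The structure $(\mathbb{R},+,\cdot)$, where $\mathbb{R}=(\mathbb{R}_+^{*}\times\mathbb{R}_+^{*})/\approx$ is the set of equivalence classes of pairs of initial segments of $\mathbb{Q}_+^{*}$ with the operations defined in the context, is a field.
   Context: $\mathbb{Q}_+^{*}$ is the set of strictly positive rational numbers with its usual operations and order. An initial segment of $\mathbb{Q}_+^{*}$ is a nonempty proper subset $A\subset\mathbb{Q}_+^{*}$ such that (1) if $y\in A$, $x\in\mathbb{Q}_+^{*}$ and $x<y$, then $x\in A$; (2) if $x\in A$, then there exists $y\in A$ with $y>x$. $\mathbb{R}_+^{*}$ denotes the set of all initial segments of $\mathbb{Q}_+^{*}$, with the operations $A+A'=\{x+x' : x\in A,\ x'\in A'\}$ and $AA'=\{xx' : x\in A,\ x'\in A'\}$ (the results are again initial segments). On $\mathbb{R}_+^{*}\times\mathbb{R}_+^{*}$ define the equivalence relation $(A,A')\approx(B,B')$ if and only if $A+B'=A'+B$. Here $\mathbb{R}$ denotes the quotient set $(\mathbb{R}_+^{*}\times\mathbb{R}_+^{*})/\approx$ (not a previously given field of real numbers), and $[(A,B)]$ the class of $(A,B)$. The (well-defined) operations on $\mathbb{R}$ are $[(A,B)]+[(A',B')]=[(A+A',\,B+B')]$ and $[(A,B)]\cdot[(A',B')]=[(AA'+BB',\,AB'+BA')]$. *)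

theory Defs
  imports Complex_Main "HOL-Algebra.Ring" "HOL-Library.Set_Algebras"
begin

definition pos_rats :: "rat set" where
  "pos_rats = {0<..}"

definition initial_segment :: "rat set \<Rightarrow> bool" where
  "initial_segment A \<longleftrightarrow>
     A \<noteq> {} \<and> A \<subset> pos_rats \<and>
     (\<forall>y\<in>A. \<forall>x\<in>pos_rats. x < y \<longrightarrow> x \<in> A) \<and>
     (\<forall>x\<in>A. \<exists>y\<in>A. y > x)"

text \<open>The sum and product of initial segments are the elementwise operations \<open>A + B\<close> and
  \<open>A * B\<close> on sets from \<^theory>\<open>HOL-Library.Set_Algebras\<close>.\<close>

definition pos_reals :: "rat set set" where
  "pos_reals = {A. initial_segment A}"

definition real_rel :: "((rat set \<times> rat set) \<times> (rat set \<times> rat set)) set" where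
  "real_rel = {((A, A'), (B, B')) | A A' B B'.
     A \<in> pos_reals \<and> A' \<in> pos_reals \<and> B \<in> pos_reals \<and> B' \<in> pos_reals \<and> A + B' = A' + B}"

definition real_set :: "(rat set \<times> rat set) set set" where
  "real_set = (pos_reals \<times> pos_reals) // real_rel"

definition real_class :: "rat set \<Rightarrow> rat set \<Rightarrow> (rat set \<times> rat set) set" where
  "real_class A B = real_rel `` {(A, B)}"

text \<open>The operations on classes are defined by taking the union of the result classes over all
  choices of representatives. As the result does not depend on the representatives, this is the
  class computed from any of them; if it did depend on them, the union would not be a class, and
  the operation would not be closed on \<open>real_set\<close>.\<close>

definition real_add ::
  "(rat set \<times> rat set) set \<Rightarrow> (rat set \<times> rat set) set \<Rightarrow> (rat set \<times> rat set) set" where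
  "real_add X Y = (\<Union>(A, B)\<in>X. \<Union>(A', B')\<in>Y. real_class (A + A') (B + B'))"

definition real_mult ::
  "(rat set \<times> rat set) set \<Rightarrow> (rat set \<times> rat set) set \<Rightarrow> (rat set \<times> rat set) set" where
  "real_mult X Y =
     (\<Union>(A, B)\<in>X. \<Union>(A', B')\<in>Y. real_class (A * A' + B * B') (A * B' + B * A'))"

end

(* The map rat_cut sends a positive real x of the library to the initial segment of positive
   rationals below x.  It is an isomorphism of the positive reals onto the initial segments,
   so [(A, B)] is determined by the difference of the reals of A and B, and the field structure
   is transported from the type real along this bijection. *)
theory Submission
  imports Defs
begin

definition rat_cut :: "real \<Rightarrow> rat set" where
  "rat_cut x = {q. 0 < q \<and> of_rat q < x}"

lemma rat_cut_in_pos_reals: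
  assumes "0 < x"
  shows "rat_cut x \<in> pos_reals"
proof -
  obtain p where "0 < real_of_rat p" "real_of_rat p < x"
    using of_rat_dense[OF assms] by blast
  then have "rat_cut x \<noteq> {}"
    by (auto simp: rat_cut_def zero_less_of_rat_iff)
  moreover have "rat_cut x \<subset> pos_rats"
  proof -
    obtain r where r: "x < real_of_rat r"
      using of_rat_dense[of x "x + 1"] by auto
    then have "0 < real_of_rat r"
      using assms by linarith
    with r have "r \<in> pos_rats - rat_cut x"
      by (auto simp: rat_cut_def pos_rats_def)
    then show ?thesis
      by (auto simp: rat_cut_def pos_rats_def)
  qed
  moreover have "\<exists>r\<in>rat_cut x. q < r" if q: "q \<in> rat_cut x" for q
  proof -
    obtain r where "real_of_rat q < real_of_rat r" "real_of_rat r < x"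
      using of_rat_dense[of "of_rat q" x] q unfolding rat_cut_def by blast
    then show ?thesis
      using q by (intro bexI[of _ r]) (auto simp: rat_cut_def of_rat_less)
  qed
  moreover have "q \<in> rat_cut x" if "r \<in> rat_cut x" "q \<in> pos_rats" "q < r" for q r
  proof -
    have "real_of_rat q < real_of_rat r"
      using that by (simp add: of_rat_less)
    then show ?thesis
      using that by (auto simp: rat_cut_def pos_rats_def)
  qed
  ultimately show ?thesis
    by (auto simp: pos_reals_def initial_segment_def)
qed

text \<open>The real is the supremum of the segment. Elements lie strictly below it because a
  segment has no greatest element; conversely, a positive rational below the supremum is below some
  element, so downward closure applies.\<close>

lemma pos_reals_cutE:
  assumes "A \<in> pos_reals"
  obtains x where "0 < x" "A = rat_cut x"
proof -
  have ne: "A \<noteq> {}" and sub: "A \<subset> pos_rats"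
    and down: "\<And>x y. y \<in> A \<Longrightarrow> x \<in> pos_rats \<Longrightarrow> x < y \<Longrightarrow> x \<in> A"
    and up: "\<And>x. x \<in> A \<Longrightarrow> \<exists>y\<in>A. y > x"
    using assms unfolding pos_reals_def initial_segment_def by blast+
  define S where "S = (of_rat ` A :: real set)"
  obtain p where p: "p \<in> pos_rats" "p \<notin> A"
    using sub by blast
  have "a \<le> p" if "a \<in> A" for a
    using that p down by (meson not_le)
  then have bdd: "bdd_above S"
    by (auto simp: S_def of_rat_less_eq intro!: bdd_aboveI[of _ "of_rat p"])
  have less_Sup: "of_rat a < Sup S" if a: "a \<in> A" for a
  proof -
    obtain b where "b \<in> A" "a < b"
      using up a by blast
    then have "real_of_rat a < of_rat b" "of_rat b \<le> Sup S"
      using bdd by (auto simp: S_def of_rat_less intro: cSup_upper)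
    then show ?thesis
      by simp
  qed
  have "A = rat_cut (Sup S)"
  proof (intro Set.set_eqI iffI)
    fix q assume "q \<in> A"
    then show "q \<in> rat_cut (Sup S)"
      using sub less_Sup by (auto simp: rat_cut_def pos_rats_def)
  next
    fix q assume q: "q \<in> rat_cut (Sup S)"
    then obtain b where "b \<in> A" "real_of_rat q < of_rat b"
      using less_cSup_iff[of S "of_rat q"] ne bdd by (auto simp: rat_cut_def S_def)
    then show "q \<in> A"
      using q down by (auto simp: rat_cut_def pos_rats_def of_rat_less)
  qed
  moreover obtain a where "a \<in> A"
    using ne by blast
  with sub have "0 < real_of_rat a"
    by (auto simp: pos_rats_def zero_less_of_rat_iff)
  with less_Sup[OF \<open>a \<in> A\<close>] have "0 < Sup S"
    by linarith
  ultimately show ?thesis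
    using that by blast
qed

lemma rat_cut_subset_imp_le:
  assumes "0 < x" "rat_cut x \<subseteq> rat_cut y"
  shows "x \<le> y"
proof (rule ccontr)
  assume "\<not> x \<le> y"
  \<comment> \<open>\<open>y\<close> may be nonpositive; the \<open>max\<close> keeps the separating
    rational positive, as membership in \<open>rat_cut x\<close> requires.\<close>
  then obtain q where "max 0 y < real_of_rat q" "real_of_rat q < x"
    using of_rat_dense[of "max 0 y" x] assms(1) by auto
  moreover from this have "0 < real_of_rat q"
    by linarith
  ultimately have "q \<in> rat_cut x - rat_cut y"
    by (auto simp: rat_cut_def)
  then show False
    using assms(2) by blast
qed

lemma rat_cut_eq_iff:
  assumes "0 < x" "0 < y"
  shows "rat_cut x = rat_cut y \<longleftrightarrow> x = y"
  using assms by (auto intro!: antisym rat_cut_subset_imp_le)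

lemma rat_cut_add:
  assumes "0 < x" "0 < y"
  shows "rat_cut x + rat_cut y = rat_cut (x + y)"
proof (intro Set.set_eqI iffI)
  fix q assume "q \<in> rat_cut x + rat_cut y"
  then show "q \<in> rat_cut (x + y)"
    by (auto simp: rat_cut_def of_rat_add elim!: set_plus_elim)
next
  fix q assume "q \<in> rat_cut (x + y)"
  then have "0 < real_of_rat q" "of_rat q < x + y"
    by (auto simp: rat_cut_def)
  \<comment> \<open>These bounds say that \<open>r\<close> and \<open>q - r\<close> are positive and
    below \<open>x\<close> and \<open>y\<close> respectively. The interval is nonempty because
    \<open>q < x + y\<close> and \<open>q\<close>, \<open>x\<close>, \<open>y\<close> are all
    positive.\<close>
  then obtain r where r: "max 0 (of_rat q - y) < real_of_rat r" "of_rat r < min x (of_rat q)"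
    using of_rat_dense[of "max 0 (of_rat q - y)" "min x (of_rat q)"] assms by auto
  then have "0 < real_of_rat r"
    by linarith
  with r have "r \<in> rat_cut x"
    by (auto simp: rat_cut_def)
  moreover have "q - r \<in> rat_cut y"
    using r by (auto simp: rat_cut_def of_rat_diff of_rat_less)
  ultimately show "q \<in> rat_cut x + rat_cut y"
    using set_plus_intro[of r "rat_cut x" "q - r" "rat_cut y"] by simp
qed

lemma rat_cut_mult:
  assumes "0 < x" "0 < y"
  shows "rat_cut x * rat_cut y = rat_cut (x * y)"
proof (intro Set.set_eqI iffI)
  fix q assume "q \<in> rat_cut x * rat_cut y"
  then show "q \<in> rat_cut (x * y)"
    using assms
    by (auto simp: rat_cut_def of_rat_mult elim!: set_times_elim intro!: mult_strict_mono)
next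
  fix q assume "q \<in> rat_cut (x * y)"
  then have q: "0 < q" "real_of_rat q / y < x"
    using assms by (auto simp: rat_cut_def field_simps)
  \<comment> \<open>In the factorization of \<open>q\<close> as \<open>r * (q / r)\<close>, the
    lower bound on \<open>r\<close> is what puts \<open>q / r\<close> below
    \<open>y\<close>.\<close>
  then obtain r where r: "real_of_rat q / y < of_rat r" "of_rat r < x"
    using of_rat_dense by blast
  have "0 < real_of_rat q / y"
    using q assms by simp
  then have "0 < real_of_rat r"
    using r by linarith
  then have "0 < r"
    by simp
  then have "r \<in> rat_cut x" "q / r \<in> rat_cut y"
    using r q assms by (auto simp: rat_cut_def of_rat_divide field_simps)
  then show "q \<in> rat_cut x * rat_cut y"
    using set_times_intro[of r "rat_cut x" "q / r" "rat_cut y"] \<open>0 < r\<close> by simp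
qed

text \<open>The element of the quotient that corresponds to the real \<open>r\<close>, listed
  explicitly by its representatives.\<close>

definition diff_class :: "real \<Rightarrow> (rat set \<times> rat set) set" where
  "diff_class r = {(rat_cut a, rat_cut b) | a b. 0 < a \<and> 0 < b \<and> a - b = r}"

lemma diff_classI:
  assumes "0 < a" "0 < b" "a - b = r"
  shows "(rat_cut a, rat_cut b) \<in> diff_class r"
  unfolding diff_class_def using assms by blast

lemma diff_classE:
  assumes "p \<in> diff_class r"
  obtains a b where "p = (rat_cut a, rat_cut b)" "0 < a" "0 < b" "a - b = r"
  using assms unfolding diff_class_def by blast

text \<open>Under \<open>rat_cut\<close>, the relation between the pairs of \<open>(a, b)\<close>
  and \<open>(c, d)\<close> reads \<open>a + d = b + c\<close>, that is,
  \<open>c - d = a - b\<close>.\<close>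

lemma real_class_cut:
  assumes "0 < a" "0 < b"
  shows "real_class (rat_cut a) (rat_cut b) = diff_class (a - b)"
proof (intro Set.set_eqI iffI)
  fix p assume "p \<in> real_class (rat_cut a) (rat_cut b)"
  then obtain B B' where p: "p = (B, B')" "B \<in> pos_reals" "B' \<in> pos_reals"
    "rat_cut a + B' = rat_cut b + B"
    by (auto simp: real_class_def real_rel_def)
  then obtain c d where cd: "0 < c" "B = rat_cut c" "0 < d" "B' = rat_cut d"
    by (meson pos_reals_cutE)
  with p assms have "a + d = b + c"
    by (simp add: rat_cut_add rat_cut_eq_iff)
  then have "c - d = a - b"
    by simp
  then show "p \<in> diff_class (a - b)"
    using p cd by (simp add: diff_classI)
next
  fix p assume "p \<in> diff_class (a - b)"
  then obtain c d where "p = (rat_cut c, rat_cut d)" "0 < c" "0 < d" "c - d = a - b"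
    by (rule diff_classE)
  moreover from this have "a + d = b + c"
    by simp
  ultimately show "p \<in> real_class (rat_cut a) (rat_cut b)"
    using assms by (auto simp: real_class_def real_rel_def rat_cut_in_pos_reals rat_cut_add)
qed

lemma diff_class_witness:
  obtains a b where "0 < a" "0 < b" "a - b = r" "(rat_cut a, rat_cut b) \<in> diff_class r"
proof
  \<comment> \<open>The shift by \<open>\<bar>r\<bar> + 1\<close> makes both components positive
    whatever the sign of \<open>r\<close>.\<close>
  show "0 < \<bar>r\<bar> + 1 + r" "0 < \<bar>r\<bar> + 1" "(\<bar>r\<bar> + 1 + r) - (\<bar>r\<bar> + 1) = r"
    by auto
  then show "(rat_cut (\<bar>r\<bar> + 1 + r), rat_cut (\<bar>r\<bar> + 1)) \<in> diff_class r"
    by (rule diff_classI)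
qed

lemma real_set_eq_range: "real_set = range diff_class"
proof (intro Set.set_eqI iffI)
  fix X assume "X \<in> real_set"
  then obtain A B where "A \<in> pos_reals" "B \<in> pos_reals" "X = real_class A B"
    by (auto simp: real_set_def real_class_def elim!: quotientE)
  moreover from this obtain a b where "0 < a" "A = rat_cut a" "0 < b" "B = rat_cut b"
    by (meson pos_reals_cutE)
  ultimately show "X \<in> range diff_class"
    by (simp add: real_class_cut)
next
  fix X assume "X \<in> range diff_class"
  then obtain r where r: "X = diff_class r"
    by blast
  obtain a b where ab: "0 < a" "0 < b" "a - b = r"
    by (rule diff_class_witness)
  then have "X = real_class (rat_cut a) (rat_cut b)"
    using r by (simp add: real_class_cut)
  with ab show "X \<in> real_set"
    by (simp add: real_set_def real_class_def quotientI rat_cut_in_pos_reals)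
qed

text \<open>With \<open>real_set_eq_range\<close>, this makes \<open>diff_class\<close> a bijection
  from the reals onto the quotient. It holds because any representative determines its difference,
  \<open>rat_cut\<close> being injective on positive reals.\<close>

lemma diff_class_eq_iff: "diff_class r = diff_class s \<longleftrightarrow> r = s"
proof
  assume eq: "diff_class r = diff_class s"
  obtain a b where ab: "0 < a" "0 < b" "a - b = r" "(rat_cut a, rat_cut b) \<in> diff_class r"
    by (rule diff_class_witness)
  then have "(rat_cut a, rat_cut b) \<in> diff_class s"
    using eq by simp
  then obtain c d where "rat_cut a = rat_cut c" "rat_cut b = rat_cut d" "0 < c" "0 < d" "c - d = s"
    by (auto elim: diff_classE)
  then show "r = s"
    using ab by (simp add: rat_cut_eq_iff)
qed simp

text \<open>Independence of representatives, in the form that both operations need: the union of a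
  constant family is that constant.\<close>

lemma UN_diff_class_const:
  assumes "\<And>a b c d. \<lbrakk>0 < a; 0 < b; a - b = r; 0 < c; 0 < d; c - d = s\<rbrakk> \<Longrightarrow>
    F (rat_cut a) (rat_cut b) (rat_cut c) (rat_cut d) = Z"
  shows "(\<Union>(A, B)\<in>diff_class r. \<Union>(A', B')\<in>diff_class s. F A B A' B') = Z"
proof -
  have "F A B A' B' = Z" if mem: "(A, B) \<in> diff_class r" "(A', B') \<in> diff_class s" for A B A' B'
  proof -
    obtain a b c d where "A = rat_cut a" "B = rat_cut b" "0 < a" "0 < b" "a - b = r"
      "A' = rat_cut c" "B' = rat_cut d" "0 < c" "0 < d" "c - d = s"
      using mem by (auto elim!: diff_classE)
    then show ?thesis
      by (simp add: assms)
  qed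
  \<comment> \<open>Nonempty index sets are essential: an empty union would be empty instead of
    \<open>Z\<close>.\<close>
  moreover obtain A B A' B' where "(A, B) \<in> diff_class r" "(A', B') \<in> diff_class s"
    by (meson diff_class_witness)
  ultimately show ?thesis
    by fast
qed

lemma real_add_diff_class: "real_add (diff_class r) (diff_class s) = diff_class (r + s)"
  unfolding real_add_def
  by (rule UN_diff_class_const) (auto simp: rat_cut_add real_class_cut algebra_simps)

text \<open>The reason is the identity
  \<open>(a * c + b * d) - (a * d + b * c) = (a - b) * (c - d)\<close>.\<close>

lemma real_mult_diff_class: "real_mult (diff_class r) (diff_class s) = diff_class (r * s)"
  unfolding real_mult_def
proof (rule UN_diff_class_const)
  fix a b c d :: real
  assume "0 < a" "0 < b" "a - b = r" "0 < c" "0 < d" "c - d = s"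
  moreover from this have "a * c + b * d - (a * d + b * c) = r * s"
    by (auto simp: algebra_simps)
  ultimately show "real_class (rat_cut a * rat_cut c + rat_cut b * rat_cut d)
      (rat_cut a * rat_cut d + rat_cut b * rat_cut c) = diff_class (r * s)"
    by (simp add: rat_cut_add rat_cut_mult real_class_cut add_pos_pos)
qed

theorem mainTheorem1:
  shows "\<exists>zer un :: (rat set \<times> rat set) set.
    field \<lparr>carrier = real_set, monoid.mult = real_mult, one = un, zero = zer, add = real_add\<rparr>"
proof (intro exI)
  let ?R = "\<lparr>carrier = real_set, monoid.mult = real_mult, one = diff_class 1,
    zero = diff_class 0, add = real_add\<rparr>"
  \<comment> \<open>Rewriting with these facts turns each axiom for \<open>?R\<close> into the
    corresponding statement about real numbers.\<close>
  note ops = real_set_eq_range real_add_diff_class real_mult_diff_class diff_class_eq_iff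
  \<comment> \<open>The form that the additive inverse axiom takes after this rewriting.\<close>
  have "\<exists>s. s + r = 0" for r :: real
    by (rule exI[of _ "- r"]) simp
  then have "abelian_group ?R"
    by (intro abelian_groupI) (auto simp: ops ac_simps)
  moreover have "Group.comm_monoid ?R"
    by (intro comm_monoidI) (auto simp: ops ac_simps)
  ultimately have "cring ?R"
    by (intro cringI) (auto simp: ops algebra_simps)
  moreover have "\<exists>Y\<in>carrier ?R. X \<otimes>\<^bsub>?R\<^esub> Y = \<one>\<^bsub>?R\<^esub>"
    if X: "X \<in> carrier ?R" "X \<noteq> \<zero>\<^bsub>?R\<^esub>" for X
  proof -
    obtain r where "X = diff_class r" "r \<noteq> 0"
      using X by (auto simp: real_set_eq_range)
    then show ?thesis
      by (intro bexI[of _ "diff_class (1 / r)"]) (simp_all add: ops)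
  qed
  ultimately show "field ?R"
    \<comment> \<open>Besides inverses, a field needs zero and one to differ; this follows from
      injectivity of \<open>diff_class\<close>.\<close>
    by (intro cring.cring_fieldI2) (auto simp: ops)
qed

end
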